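(* Let $F$ be a graph with girth at least $5$ and let $G$ be any inflation of the complement $\overline{F}$. If $G$ is connected and $\alpha(G)=2$, then $G$ has a non-empty connected dominating matching.
   Context: All graphs are finite and simple; the girth of a graph is the length of its shortest cycle (infinite for forests). An inflation of a graph $H$ is obtained by choosing integers $c_x\ge 0$ for $x\in V(H)$, replacing each $x$ by a clique $C_x$ of order $c_x$, with every vertex of $C_x$ adjacent to every vertex of $C_y$ ($x\neq y$) if $xy\in E(H)$ and no edges between them otherwise. A matching $M$ is connected if for any two edges $e,f\in M$ some endpoint of $e$ is adjacent to some endpoint of $f$; it is dominating if every vertex not covered by $M$ is adjacent to at least one endpoint of each edge of $M$. *)

theory Defs
  imports "Graph_Theory.Digraph_Component" "HOL-Library.Extended_Nat"
begin

text \<open>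
  Finite simple graphs are the \<^emph>\<open>pair_graph\<close>s of the Graph Theory library: loop-free symmetric
  digraphs on a finite vertex set, each undirected edge being a pair of opposite arcs.
\<close>

definition edges :: "'a pair_pre_digraph \<Rightarrow> 'a set set" where
  "edges G = {{u, v} | u v. (u, v) \<in> parcs G}"

text \<open>
  A directed cycle of length at least 3 in a symmetric digraph is an undirected cycle with an
  orientation and a starting point; the length bound only excludes \<open>u, v, u\<close>, which the
  library counts as a cycle. The infimum over the empty set is \<open>\<infinity>\<close>.
\<close>

definition girth :: "'a pair_pre_digraph \<Rightarrow> enat" where
  "girth G = (INF p \<in> {p. pre_digraph.cycle (with_proj G) p \<and> 3 \<le> length p}. enat (length p))"

definition complement :: "'a pair_pre_digraph \<Rightarrow> 'a pair_pre_digraph" where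
  "complement G = \<lparr> pverts = pverts G,
     parcs = {(u, v). u \<in> pverts G \<and> v \<in> pverts G \<and> u \<noteq> v \<and> (u, v) \<notin> parcs G} \<rparr>"

text \<open>
  Inflations are taken up to the choice of the disjoint sets carrying the cliques, so \<open>G\<close> may
  live on any vertex type. Some cliques may be empty.
\<close>

definition is_inflation :: "'b pair_pre_digraph \<Rightarrow> 'a pair_pre_digraph \<Rightarrow> bool" where
  "is_inflation G H \<longleftrightarrow> (\<exists>(c :: 'a \<Rightarrow> nat) (C :: 'a \<Rightarrow> 'b set).
     (\<forall>x \<in> pverts H. finite (C x) \<and> card (C x) = c x) \<and>
     (\<forall>x \<in> pverts H. \<forall>y \<in> pverts H. x \<noteq> y \<longrightarrow> C x \<inter> C y = {}) \<and>
     pverts G = (\<Union>x \<in> pverts H. C x) \<and>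
     parcs G = {(u, v). \<exists>x \<in> pverts H. \<exists>y \<in> pverts H. u \<in> C x \<and> v \<in> C y \<and>
                          (x = y \<and> u \<noteq> v \<or> x \<noteq> y \<and> (x, y) \<in> parcs H)})"

definition independent :: "'a pair_pre_digraph \<Rightarrow> 'a set \<Rightarrow> bool" where
  "independent G S \<longleftrightarrow> S \<subseteq> pverts G \<and> (\<forall>u \<in> S. \<forall>v \<in> S. (u, v) \<notin> parcs G)"

definition independence_number :: "'a pair_pre_digraph \<Rightarrow> nat" where
  "independence_number G = Max (card ` {S. independent G S})"

definition matching :: "'a pair_pre_digraph \<Rightarrow> 'a set set \<Rightarrow> bool" where
  "matching G M \<longleftrightarrow> M \<subseteq> edges G \<and> (\<forall>e \<in> M. \<forall>f \<in> M. e \<noteq> f \<longrightarrow> e \<inter> f = {})"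

definition connected_matching :: "'a pair_pre_digraph \<Rightarrow> 'a set set \<Rightarrow> bool" where
  "connected_matching G M \<longleftrightarrow> matching G M \<and>
     (\<forall>e \<in> M. \<forall>f \<in> M. e \<noteq> f \<longrightarrow> (\<exists>u \<in> e. \<exists>v \<in> f. (u, v) \<in> parcs G))"

definition dominating_matching :: "'a pair_pre_digraph \<Rightarrow> 'a set set \<Rightarrow> bool" where
  "dominating_matching G M \<longleftrightarrow> matching G M \<and>
     (\<forall>w \<in> pverts G - \<Union>M. \<forall>e \<in> M. \<exists>u \<in> e. (w, u) \<in> parcs G)"

lemma pair_graphI:
  assumes "finite (pverts G)" "parcs G \<subseteq> pverts G \<times> pverts G"
    and "sym (parcs G)" "irrefl (parcs G)"
  shows "pair_graph G"
proof
  show "finite (parcs G)"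
    using assms(1,2) finite_subset by blast
  show "symmetric (with_proj G)"
    using assms(3) by (simp add: symmetric_def)
  fix e assume e: "e \<in> parcs G"
  show "fst e \<in> pverts G" "snd e \<in> pverts G"
    using e assms(2) by auto
  show "fst e \<noteq> snd e"
    using e assms(4) by (metis irrefl_def prod.collapse)
qed (fact assms(1))

lemma pair_graph_complement:
  assumes "pair_graph G"
  shows "pair_graph (complement G)"
proof -
  interpret pair_graph G by fact
  show ?thesis
  proof (rule pair_graphI)
    show "sym (parcs (complement G))"
      by (rule symI) (simp add: complement_def, metis arcs_symmetric)
  qed (simp_all add: complement_def irrefl_def subset_iff)
qed

lemma pair_graph_inflation:
  assumes "pair_graph H" and "is_inflation G H"
  shows "pair_graph G"
proof -
  interpret pair_graph H by fact
  obtain c C where C: "\<forall>x \<in> pverts H. finite (C x) \<and> card (C x) = c x"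
      "\<forall>x \<in> pverts H. \<forall>y \<in> pverts H. x \<noteq> y \<longrightarrow> C x \<inter> C y = {}"
    and V: "pverts G = (\<Union>x \<in> pverts H. C x)"
    and E: "parcs G = {(u, v). \<exists>x \<in> pverts H. \<exists>y \<in> pverts H. u \<in> C x \<and> v \<in> C y \<and>
                          (x = y \<and> u \<noteq> v \<or> x \<noteq> y \<and> (x, y) \<in> parcs H)}"
    using assms(2) unfolding is_inflation_def by (elim exE conjE) (rule that)
  show ?thesis
  proof (rule pair_graphI)
    show "finite (pverts G)"
      using C(1) V by simp
    show "parcs G \<subseteq> pverts G \<times> pverts G"
      unfolding E V by blast
    show "sym (parcs G)"
      by (rule symI) (simp add: E, metis arcs_symmetric)
    show "irrefl (parcs G)"
      unfolding irrefl_def E using C(2) by (simp add: disjoint_iff, metis)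
  qed
qed

end

theory Submission
  imports Defs
begin

text \<open>
  Call \<open>x\<close> occupied if its clique \<open>C x\<close> is non-empty; all notions below refer to the subgraph of
  \<open>F\<close> induced by the occupied vertices. Since \<open>F\<close> has no 4-cycle, any matching whose edges join
  distinct cliques is automatically connected. If some \<open>x\<close> has at most one neighbour \<open>w\<close>,
  connectedness of \<open>G\<close> yields a \<open>z\<close> that is not adjacent to \<open>w\<close>, so \<open>x\<close> and \<open>z\<close> have no common
  neighbour and a single edge between their cliques dominates. Otherwise choose \<open>x\<close> with \<open>C x\<close>
  smallest, then a neighbour \<open>y\<close> of \<open>x\<close> with \<open>C y\<close> smallest, and complete these to a path
  \<open>a, x, y, b\<close>. Match \<open>C x\<close> into \<open>C b\<close> and \<open>C y\<close> into \<open>C a\<close>: the only vertices that miss an edge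
  of this matching lie in \<open>C y\<close> or \<open>C x\<close>, which are covered.
\<close>

lemma girth_le_cycle_length:
  assumes "pre_digraph.cycle (with_proj G) p" "3 \<le> length p"
  shows "girth G \<le> enat (length p)"
  unfolding girth_def using assms by (intro INF_lower) simp

lemma girth_ge_5_no_triangle:
  assumes "pair_graph F" "girth F \<ge> 5"
    and "(x, y) \<in> parcs F" "(y, z) \<in> parcs F" "(z, x) \<in> parcs F"
  shows False
proof -
  interpret pair_graph F by fact
  let ?p = "[(x, y), (y, z), (z, x)]"
  have "x \<noteq> y" "y \<noteq> z" "z \<noteq> x"
    using assms(3-5) no_loops' by blast+
  moreover have "awalk x ?p x"
    using assms(3-5) by (auto simp: awalk_simps in_arcsD1 in_arcsD2)
  ultimately have "cycle ?p"
    unfolding cycle_def by (intro exI[of _ x]) auto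
  then have "girth F \<le> enat 3"
    using girth_le_cycle_length[of F ?p] by (simp add: eval_nat_numeral)
  with assms(2) have "enat 5 \<le> enat 3"
    by (metis order_trans numeral_eq_enat)
  then show False by simp
qed

text \<open>Loop-freeness separates consecutive vertices. The two inequalities separate opposite
  ones, so the closed walk does not merely retrace edges.\<close>

lemma girth_ge_5_no_4_cycle:
  assumes "pair_graph F" "girth F \<ge> 5"
    and "(w, x) \<in> parcs F" "(x, y) \<in> parcs F" "(y, z) \<in> parcs F" "(z, w) \<in> parcs F"
    and "w \<noteq> y" "x \<noteq> z"
  shows False
proof -
  interpret pair_graph F by fact
  let ?p = "[(w, x), (x, y), (y, z), (z, w)]"
  have "w \<noteq> x" "x \<noteq> y" "y \<noteq> z" "z \<noteq> w"
    using assms(3-6) no_loops' by blast+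
  moreover have "awalk w ?p w"
    using assms(3-6) by (auto simp: awalk_simps in_arcsD1 in_arcsD2)
  ultimately have "cycle ?p"
    using assms(7,8) unfolding cycle_def by (intro exI[of _ w]) auto
  then have "girth F \<le> enat 4"
    using girth_le_cycle_length[of F ?p] by (simp add: eval_nat_numeral)
  with assms(2) have "enat 5 \<le> enat 4"
    by (metis order_trans numeral_eq_enat)
  then show False by simp
qed

text \<open>Here \<open>f\<close> sends a vertex to the index of its clique. As \<open>F\<close> has
  no loops, adjacency inside a clique and between cliques becomes a single condition on
  \<open>f u\<close> and \<open>f v\<close>.\<close>

lemma inflation_complement_class_map:
  assumes "pair_graph F" "is_inflation G (complement F)"
  obtains f where
    "parcs G = {(u, v). u \<in> pverts G \<and> v \<in> pverts G \<and> u \<noteq> v \<and> (f u, f v) \<notin> parcs F}"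
proof -
  interpret pair_graph F by fact
  obtain c C where disj: "\<forall>x \<in> pverts F. \<forall>y \<in> pverts F. x \<noteq> y \<longrightarrow> C x \<inter> C y = {}"
    and V: "pverts G = (\<Union>x \<in> pverts F. C x)"
    and E: "parcs G = {(u, v). \<exists>x \<in> pverts F. \<exists>y \<in> pverts F. u \<in> C x \<and> v \<in> C y \<and>
                          (x = y \<and> u \<noteq> v \<or> x \<noteq> y \<and> (x, y) \<in> parcs (complement F))}"
    using assms(2) unfolding is_inflation_def
    by (elim exE conjE) (rule that, simp_all add: complement_def)
  obtain f where f: "\<And>u. u \<in> pverts G \<Longrightarrow> f u \<in> pverts F \<and> u \<in> C (f u)"
    using V by (metis UN_E)
  have uniq: "x = f u" if "x \<in> pverts F" "u \<in> C x" for x u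
    using that f[of u] disj V by blast
  have "(u, v) \<in> parcs G \<longleftrightarrow>
      u \<in> pverts G \<and> v \<in> pverts G \<and> u \<noteq> v \<and> (f u, f v) \<notin> parcs F" for u v
  proof
    assume "(u, v) \<in> parcs G"
    then obtain x y where xy: "x \<in> pverts F" "y \<in> pverts F" "u \<in> C x" "v \<in> C y"
      and adj: "x = y \<and> u \<noteq> v \<or> x \<noteq> y \<and> (x, y) \<notin> parcs F"
      unfolding E complement_def by auto
    moreover have "x = f u" "y = f v"
      using uniq xy by blast+
    ultimately show "u \<in> pverts G \<and> v \<in> pverts G \<and> u \<noteq> v \<and> (f u, f v) \<notin> parcs F"
      using V no_loops' by blast
  next
    assume "u \<in> pverts G \<and> v \<in> pverts G \<and> u \<noteq> v \<and> (f u, f v) \<notin> parcs F"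
    then show "(u, v) \<in> parcs G"
      using f[of u] f[of v] unfolding E complement_def by auto
  qed
  then show thesis
    by (intro that[of f]) auto
qed

lemma connected_crossing_arc:
  assumes "pair_graph G" "Digraph_Component.connected (with_proj G)"
    and "u \<in> pverts G" "u \<in> S" "v \<in> pverts G" "v \<notin> S"
  obtains a b where "(a, b) \<in> parcs G" "a \<in> S" "b \<notin> S"
proof -
  interpret pair_graph G by fact
  have "u \<rightarrow>\<^sup>*\<^bsub>with_proj G\<^esub> v"
    using symmetric_connected_imp_strongly_connected[OF _ assms(2)] assms(3,5) sym_arcs
    by (auto simp: strongly_connected_def)
  then have "v \<in> S" if "\<forall>a b. (a, b) \<in> parcs G \<longrightarrow> a \<in> S \<longrightarrow> b \<in> S"
    by (induct rule: reachable_induct) (use that assms(4) in auto)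
  then show thesis
    using that assms(6) by blast
qed

lemma independence_number_2_nonadjacent:
  assumes "pair_graph G" "independence_number G = 2"
  obtains u v where "u \<in> pverts G" "v \<in> pverts G" "u \<noteq> v" "(u, v) \<notin> parcs G"
proof -
  interpret pair_graph G by fact
  have "finite {S. independent G S}"
    by (rule finite_subset[of _ "Pow (pverts G)"]) (auto simp: independent_def)
  moreover have "{} \<in> {S. independent G S}"
    by (simp add: independent_def)
  ultimately have "2 \<in> card ` {S. independent G S}"
    using assms(2) Max_in[of "card ` {S. independent G S}"]
    unfolding independence_number_def by (metis empty_iff finite_imageI image_is_empty)
  then obtain S where "independent G S" "card S = 2"
    by auto
  then show thesis
    using that by (auto simp: card_2_iff independent_def)
qed

text \<open>Serves both cases of the theorem: the matching consists of the edges from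
  \<open>u\<close> in \<open>D\<close> to \<open>k u\<close>. A vertex missing such an edge is,
  under \<open>f\<close>, a common \<open>A\<close>-neighbour of its ends, so \<open>common\<close>
  puts it in \<open>D\<close>, where it is covered.\<close>

lemma connected_dominating_matching_from_injection:
  fixes f :: "'b \<Rightarrow> 'a"
  assumes E: "parcs G = {(u, v). u \<in> pverts G \<and> v \<in> pverts G \<and> u \<noteq> v \<and> (f u, f v) \<notin> A}"
    and "sym A"
    and no_4_cycle: "\<And>w x y z. (w, x) \<in> A \<Longrightarrow> (x, y) \<in> A \<Longrightarrow> (y, z) \<in> A \<Longrightarrow> (z, w) \<in> A \<Longrightarrow>
      w \<noteq> y \<Longrightarrow> x \<noteq> z \<Longrightarrow> False"
    and D: "D \<noteq> {}" "D \<subseteq> pverts G"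
    and k: "inj_on k D" "k ` D \<subseteq> pverts G - D"
    and nonadj: "\<And>u. u \<in> D \<Longrightarrow> f u \<noteq> f (k u) \<and> (f u, f (k u)) \<notin> A"
    and common: "\<And>u w. u \<in> D \<Longrightarrow> w \<in> pverts G \<Longrightarrow> (f w, f u) \<in> A \<Longrightarrow> (f w, f (k u)) \<in> A \<Longrightarrow> w \<in> D"
  shows "\<exists>M. M \<noteq> {} \<and> connected_matching G M \<and> dominating_matching G M"
proof -
  define M where "M = (\<lambda>u. {u, k u}) ` D"
  have disj: "{u, k u} \<inter> {v, k v} = {}" if "u \<in> D" "v \<in> D" "u \<noteq> v" for u v
    using that k by (auto dest: inj_onD)
  have "{u, k u} \<in> edges G" if "u \<in> D" for u
    using that nonadj[OF that] D k unfolding edges_def E by blast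
  then have "M \<subseteq> edges G"
    by (auto simp: M_def)
  moreover have "e \<inter> e' = {}" if "e \<in> M" "e' \<in> M" "e \<noteq> e'" for e e'
  proof -
    obtain u v where "u \<in> D" "v \<in> D" "e = {u, k u}" "e' = {v, k v}"
      using \<open>e \<in> M\<close> \<open>e' \<in> M\<close> unfolding M_def by blast
    then show ?thesis
      using disj[of u v] \<open>e \<noteq> e'\<close> by (cases "u = v") simp_all
  qed
  ultimately have matching: "matching G M"
    unfolding matching_def by blast
  have linked: "\<exists>a \<in> {u, k u}. \<exists>b \<in> {v, k v}. (a, b) \<in> parcs G"
    if uv: "u \<in> D" "v \<in> D" "u \<noteq> v" for u v
  proof (rule ccontr)
    assume "\<not> ?thesis"
    moreover have "a \<in> pverts G" if "a \<in> {u, k u} \<union> {v, k v}" for a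
      using that uv D k by blast
    ultimately have adj: "(f a, f b) \<in> A" if "a \<in> {u, k u}" "b \<in> {v, k v}" for a b
      using that disj[OF uv] unfolding E by blast
    \<comment> \<open>Two unlinked matching edges span a 4-cycle in \<open>A\<close>; its opposite
      corners are the ends of one edge, which \<open>nonadj\<close> makes distinct.\<close>
    then have "(f u, f v) \<in> A" "(f v, f (k u)) \<in> A" "(f (k u), f (k v)) \<in> A" "(f (k v), f u) \<in> A"
      using \<open>sym A\<close> by (auto dest: symD)
    then show False
      using no_4_cycle nonadj uv by blast
  qed
  have "\<exists>a \<in> e. \<exists>b \<in> e'. (a, b) \<in> parcs G" if "e \<in> M" "e' \<in> M" "e \<noteq> e'" for e e'
  proof -
    obtain u v where "u \<in> D" "v \<in> D" "e = {u, k u}" "e' = {v, k v}"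
      using \<open>e \<in> M\<close> \<open>e' \<in> M\<close> unfolding M_def by blast
    then show ?thesis
      using linked[of u v] \<open>e \<noteq> e'\<close> by (cases "u = v") simp_all
  qed
  then have "connected_matching G M"
    using matching unfolding connected_matching_def by blast
  moreover have "\<exists>a \<in> {u, k u}. (w, a) \<in> parcs G"
    if "u \<in> D" "w \<in> pverts G" "w \<notin> \<Union>M" for u w
  proof -
    have "w \<notin> D" "w \<noteq> u" "w \<noteq> k u"
      using that by (auto simp: M_def)
    moreover have "u \<in> pverts G" "k u \<in> pverts G"
      using that D k by auto
    ultimately show ?thesis
      using common[of u w] that by (auto simp: E)
  qed
  then have "dominating_matching G M"
    using matching unfolding dominating_matching_def by (auto simp: M_def)
  ultimately show ?thesis
    using D by (auto simp: M_def)
qed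

theorem theorem3p1:
  fixes F :: "'a pair_pre_digraph" and G :: "'b pair_pre_digraph"
  assumes "pair_graph F"
    and "girth F \<ge> 5"
    and "is_inflation G (complement F)"
    and "Digraph_Component.connected (with_proj G)"
    and "independence_number G = 2"
  shows "\<exists>M. M \<noteq> {} \<and> connected_matching G M \<and> dominating_matching G M"
proof -
  interpret F: pair_graph F by fact
  have pgG: "pair_graph G"
    using assms(1,3) pair_graph_complement pair_graph_inflation by blast
  then interpret G: pair_graph G .
  obtain f where
    E: "parcs G = {(u, v). u \<in> pverts G \<and> v \<in> pverts G \<and> u \<noteq> v \<and> (f u, f v) \<notin> parcs F}"
    using inflation_complement_class_map[OF assms(1,3)] by blast
  define A where "A = parcs F"
  define V where "V = f ` pverts G"
  define C where "C x = {u \<in> pverts G. f u = x}" for x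
  note E = E[folded A_def]
  have symA: "sym A"
    unfolding A_def using F.arcs_symmetric by (auto intro: symI)
  have irrefl: "(x, x) \<notin> A" for x
    unfolding A_def using F.no_loops' by blast
  have no3: "False" if "(x, y) \<in> A" "(y, z) \<in> A" "(z, x) \<in> A" for x y z
    using girth_ge_5_no_triangle[OF assms(1,2)] that unfolding A_def by blast
  have no4: "False" if "(w, x) \<in> A" "(x, y) \<in> A" "(y, z) \<in> A" "(z, w) \<in> A" "w \<noteq> y" "x \<noteq> z"
    for w x y z
    using girth_ge_5_no_4_cycle[OF assms(1,2)] that unfolding A_def by blast
  note build = connected_dominating_matching_from_injection[OF E symA]
  have finC: "finite (C x)" for x
    unfolding C_def by simp
  \<comment> \<open>Non-adjacent vertices of \<open>G\<close> lie in cliques whose indices are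
    adjacent in \<open>F\<close>, so the occupied part of \<open>F\<close> has an edge.\<close>
  obtain p q where pq: "p \<in> V" "q \<in> V" "(p, q) \<in> A"
    using independence_number_2_nonadjacent[OF pgG assms(5)]
    by (simp add: E V_def) (metis imageI)
  show ?thesis
  \<comment> \<open>The case split asks for two occupied vertices at distance at least 3 in the
    occupied part of \<open>F\<close>. If there are none, \<open>near\<close> bounds all distances
    by 2.\<close>
  proof (cases "\<exists>v z. v \<in> V \<and> z \<in> V \<and> v \<noteq> z \<and> (v, z) \<notin> A \<and> (\<forall>w \<in> V. (w, v) \<notin> A \<or> (w, z) \<notin> A)")
    case True
    then obtain s t where "s \<in> pverts G" "t \<in> pverts G" "f s \<noteq> f t" "(f s, f t) \<notin> A"
      "\<forall>w \<in> pverts G. (f w, f s) \<notin> A \<or> (f w, f t) \<notin> A"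
      unfolding V_def by blast
    then show ?thesis
      by (intro build[where D = "{s}" and k = "\<lambda>_. t"]) (auto dest: no4)
  next
    case False
    then have near: "v = z \<or> (v, z) \<in> A \<or> (\<exists>w \<in> V. (w, v) \<in> A \<and> (w, z) \<in> A)"
      if "v \<in> V" "z \<in> V" for v z
      using that by blast
    have nbr: "\<exists>w \<in> V. (v, w) \<in> A" if "v \<in> V" for v
      using near[OF that pq(1)] near[OF that pq(2)] pq symA by (auto dest: symD)
    have second_nbr: "\<exists>w' \<in> V. (v, w') \<in> A \<and> w' \<noteq> w" if v: "v \<in> V" and w: "w \<in> V" "(v, w) \<in> A" for v w
    proof (rule ccontr)
      assume only: "\<not> ?thesis"
      obtain s t where "s \<in> pverts G" "f s = w" "t \<in> pverts G" "f t = v"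
        using v w unfolding V_def by blast
      moreover have "v \<noteq> w"
        using w irrefl by blast
      \<comment> \<open>The arc leaving the clique of \<open>w\<close> ends in a clique whose index
        is neither \<open>w\<close> nor adjacent to \<open>w\<close>. If \<open>w\<close> were the
        only neighbour of \<open>v\<close>, that index would be at distance more than 2 from
        \<open>v\<close>.\<close>
      ultimately obtain a b where "(a, b) \<in> parcs G" "f a = w" "f b \<noteq> w"
        using connected_crossing_arc[OF pgG assms(4), of s "{u. f u = w}" t] by auto
      then have b: "f b \<in> V" "f b \<noteq> w" "(w, f b) \<notin> A"
        unfolding E V_def by auto
      then show False
        using near[OF v b(1)] only w symA by (metis symD)
    qed
    have finV: "finite V"
      unfolding V_def by simp
    obtain x where x: "x \<in> V" and xmin: "\<And>z. z \<in> V \<Longrightarrow> card (C x) \<le> card (C z)"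
      using ex_min_if_finite[of "(\<lambda>z. card (C z)) ` V"] finV pq(1) by (auto simp: not_less)
    define N where "N = {y \<in> V. (x, y) \<in> A}"
    have "finite N" "N \<noteq> {}"
      using finV nbr[OF x] by (auto simp: N_def)
    \<comment> \<open>Minimality among the neighbours of \<open>x\<close> suffices, since
      \<open>C y\<close> is to be injected into \<open>C a\<close> with \<open>a\<close> in
      \<open>N\<close>.\<close>
    then obtain y where "y \<in> N" and ymin: "\<And>z. z \<in> N \<Longrightarrow> card (C y) \<le> card (C z)"
      using ex_min_if_finite[of "(\<lambda>z. card (C z)) ` N"] by (auto simp: not_less)
    then have y: "y \<in> V" "(x, y) \<in> A" "(y, x) \<in> A"
      using symA by (auto simp: N_def dest: symD)
    obtain a where a: "a \<in> V" "(x, a) \<in> A" "(a, x) \<in> A" "a \<noteq> y"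
      using second_nbr[OF x y(1,2)] symA by (metis symD)
    obtain b where b: "b \<in> V" "(y, b) \<in> A" "(b, y) \<in> A" "b \<noteq> x"
      using second_nbr[OF y(1) x y(3)] symA by (metis symD)
    have "a \<in> N"
      using a by (simp add: N_def)
    obtain g where g: "inj_on g (C x)" "g ` C x \<subseteq> C b"
      using card_le_inj[OF finC finC xmin[OF b(1)]] by blast
    obtain h where h: "inj_on h (C y)" "h ` C y \<subseteq> C a"
      using card_le_inj[OF finC finC ymin[OF \<open>a \<in> N\<close>]] by blast
    define k where "k u = (if f u = x then g u else h u)" for u
    \<comment> \<open>If \<open>a = b\<close>, then \<open>x\<close>, \<open>y\<close>,
      \<open>a\<close> would form a triangle.\<close>
    have ne: "x \<noteq> y" "a \<noteq> x" "b \<noteq> y" "a \<noteq> b"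
      using irrefl a b y no3[of x y a] by blast+
    have gC: "g u \<in> pverts G" "f (g u) = b" if "u \<in> C x" for u
      using g that by (auto simp: C_def)
    have hC: "h u \<in> pverts G" "f (h u) = a" if "u \<in> C y" for u
      using h that by (auto simp: C_def)
    have kx: "k u = g u" "f u = x" if "u \<in> C x" for u
      using that by (auto simp: k_def C_def)
    have ky: "k u = h u" "f u = y" if "u \<in> C y" for u
      using that ne by (auto simp: k_def C_def)
    \<comment> \<open>A common neighbour of \<open>x\<close> and \<open>b\<close> other than
      \<open>y\<close> would close a 4-cycle. Hence a vertex missing an edge between
      \<open>C x\<close> and \<open>C b\<close> lies in \<open>C y\<close>; \<open>common_ya\<close>
      is the mirror image.\<close>
    have common_xb: "z = y" if "(z, x) \<in> A" "(z, b) \<in> A" for z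
      using no4[of z x y b] that y b symA by (metis symD)
    have common_ya: "z = x" if "(z, y) \<in> A" "(z, a) \<in> A" for z
      using no4[of z y x a] that y a symA by (metis symD)
    have kD: "k u \<in> pverts G" "f u = x \<and> f (k u) = b \<or> f u = y \<and> f (k u) = a"
      if "u \<in> C x \<union> C y" for u
      using that gC[of u] hC[of u] kx[of u] ky[of u] by auto
    have in_D: "w \<in> C x \<union> C y \<longleftrightarrow> w \<in> pverts G \<and> (f w = x \<or> f w = y)" for w
      by (auto simp: C_def)
    show ?thesis
    proof (rule build[where D = "C x \<union> C y" and k = k])
      show False if "(w, x) \<in> A" "(x, y) \<in> A" "(y, z) \<in> A" "(z, w) \<in> A" "w \<noteq> y" "x \<noteq> z"
        for w x y z
        using no4 that by blast
      show "C x \<union> C y \<noteq> {}"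
        using x by (auto simp: V_def C_def)
      show "C x \<union> C y \<subseteq> pverts G"
        by (auto simp: C_def)
      show "inj_on k (C x \<union> C y)"
      proof (rule inj_onI)
        fix u v assume uv: "u \<in> C x \<union> C y" "v \<in> C x \<union> C y" "k u = k v"
        then show "u = v"
          using g(1) h(1) ne gC hC kx ky by (metis UnE inj_onD)
      qed
      show "k ` (C x \<union> C y) \<subseteq> pverts G - (C x \<union> C y)"
      proof (rule image_subsetI)
        fix u assume "u \<in> C x \<union> C y"
        then show "k u \<in> pverts G - (C x \<union> C y)"
          using kD[of u] ne a(4) b(4) unfolding Diff_iff in_D by metis
      qed
      show "f u \<noteq> f (k u) \<and> (f u, f (k u)) \<notin> A" if "u \<in> C x \<union> C y" for u
        \<comment> \<open>Joining the ends of a two-edge path \<open>x\<close>, \<open>y\<close>,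
          \<open>b\<close> or \<open>y\<close>, \<open>x\<close>, \<open>a\<close> would create a
          triangle.\<close>
        using kD(2)[OF that] a b y no3[of x b y] no3[of y a x] by metis
      show "w \<in> C x \<union> C y"
        if "u \<in> C x \<union> C y" "w \<in> pverts G" "(f w, f u) \<in> A" "(f w, f (k u)) \<in> A" for u w
        using kD(2)[OF that(1)] that(2-4) common_xb common_ya unfolding in_D by metis
    qed
  qed
qed

end
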